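(* Let $0<c<1$ be fixed and let $m=cn$ (with $n$ ranging over positive integers such that $cn$ is an integer). Then for all $p\in[0,1]$, as $n\to\infty$, $$\|Q_{m,n,p}-\mathrm{Uni}_n\|_{\mathrm{TV}}=\Theta\left(\frac1n\right),$$ where $Q_{m,n,p}$ is the conditional distribution of $a_m$ given $\alpha\in\mathrm{PF}_{m,n}$ under the probabilistic parking protocol with parameter $p$, and $\mathrm{Uni}_n$ is the uniform distribution on $[n]$.
   Context: $[n]=\{1,\ldots,n\}$. Probabilistic parking protocol with parameter $p\in[0,1]$: there are $m$ cars and a one-way street with $n\ge m$ spots numbered $1,\ldots,n$. Cars $1,\ldots,m$ arrive in order; car $i$ has preference $a_i\in[n]$ and first goes to spot $a_i$. If spot $a_i$ is unoccupied, the car parks there. If it is occupied, the driver tosses (once) a biased coin, independent of everything else: with probability $p$ the car moves forward and parks in the first unoccupied spot with number greater than $a_i$, if one exists; with probability $1-p$ the car moves backward and parks in the first unoccupied spot encountered (the largest unoccupied number less than $a_i$), if one exists. If there is no unoccupied spot in the chosen direction, the car fails to park. The preference list $\alpha=(a_1,\ldots,a_m)$ is chosen uniformly at random from $[n]^m$. "$\alpha\in\mathrm{PF}_{m,n}$" denotes the event that all $m$ cars with preference list $\alpha$ succeed in parking; probabilities are over both the uniform choice of $\alpha$ and the coin tosses. $Q_{m,n,p}(j)=\mathbb{P}(a_m=j\mid\alpha\in\mathrm{PF}_{m,n})$ for $j\in[n]$. The total variation distance of probability distributions $P,Q$ on $[n]$ is $\|P-Q\|_{\mathrm{TV}}=\frac12\sum_{j=1}^n|P(j)-Q(j)|$.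 $f(n)=\Theta(1/n)$ means that there are constants $C_1,C_2>0$ (here allowed to depend on $c$ and $p$) with $C_1/n\le f(n)\le C_2/n$ for all sufficiently large admissible $n$. *)

theory Defs
  imports "HOL-Probability.Probability"
begin

text \<open>In \<open>park_spot\<close> the set \<open>S\<close> is the set of occupied spots and \<open>a\<close> the preference
  of the arriving car; the result \<open>None\<close> means that the car fails to park.\<close>

definition forward_spot :: "nat \<Rightarrow> nat set \<Rightarrow> nat \<Rightarrow> nat option" where
  "forward_spot n S a =
     (let F = {k \<in> {1..n}. a < k \<and> k \<notin> S} in if F = {} then None else Some (Min F))"

definition backward_spot :: "nat \<Rightarrow> nat set \<Rightarrow> nat \<Rightarrow> nat option" where
  "backward_spot n S a =
     (let B = {k \<in> {1..n}. k < a \<and> k \<notin> S} in if B = {} then None else Some (Max B))"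

definition park_spot :: "nat \<Rightarrow> real \<Rightarrow> nat set \<Rightarrow> nat \<Rightarrow> nat option pmf" where
  "park_spot n p S a =
     (if a \<notin> S then return_pmf (Some a)
      else map_pmf (\<lambda>fwd. if fwd then forward_spot n S a else backward_spot n S a)
             (bernoulli_pmf p))"

text \<open>The random list of outcomes of the cars, in order of arrival. A car that fails to park
  leaves the set of occupied spots unchanged.\<close>

fun park_outcomes :: "nat \<Rightarrow> real \<Rightarrow> nat set \<Rightarrow> nat list \<Rightarrow> nat option list pmf" where
  "park_outcomes n p S [] = return_pmf []"
| "park_outcomes n p S (a # as) =
     bind_pmf (park_spot n p S a) (\<lambda>r.
       map_pmf (\<lambda>rs. r # rs) (park_outcomes n p (S \<union> set_option r) as))"

definition preference_lists :: "nat \<Rightarrow> nat \<Rightarrow> nat list set" where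
  "preference_lists m n = {\<alpha>. length \<alpha> = m \<and> set \<alpha> \<subseteq> {1..n}}"

text \<open>Joint law of the preference list and the outcomes.\<close>

definition parking_pmf :: "nat \<Rightarrow> nat \<Rightarrow> real \<Rightarrow> (nat list \<times> nat option list) pmf" where
  "parking_pmf m n p =
     bind_pmf (pmf_of_set (preference_lists m n)) (\<lambda>\<alpha>.
       map_pmf (\<lambda>rs. (\<alpha>, rs)) (park_outcomes n p {} \<alpha>))"

definition all_parked :: "nat list \<times> nat option list \<Rightarrow> bool" where
  "all_parked \<omega> \<longleftrightarrow> None \<notin> set (snd \<omega>)"

text \<open>Lists are indexed from 0, so the preference of car \<open>m\<close> is the entry at \<open>m - 1\<close>
  (meaningful for \<open>m \<ge> 1\<close>).\<close>

definition Q_park :: "nat \<Rightarrow> nat \<Rightarrow> real \<Rightarrow> nat \<Rightarrow> real" where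
  "Q_park m n p j =
     cond_prob (measure_pmf (parking_pmf m n p)) (\<lambda>\<omega>. fst \<omega> ! (m - 1) = j) all_parked"

definition Uni :: "nat \<Rightarrow> nat \<Rightarrow> real" where
  "Uni n j = pmf (pmf_of_set {1..n}) j"

definition tv_dist :: "nat \<Rightarrow> (nat \<Rightarrow> real) \<Rightarrow> (nat \<Rightarrow> real) \<Rightarrow> real" where
  "tv_dist n P Q = (1/2) * (\<Sum>j=1..n. \<bar>P j - Q j\<bar>)"

end

theory Submission
  imports Defs
begin

text \<open>
  The proof rests on one count. Weight every preference list of \<open>k\<close> cars by the probability that
  all of them park on a street with \<open>n\<close> spots. The total weight is
  \<open>(n + 1 - k) * (n + 1) ^ (k - 1)\<close>, whatever \<open>p\<close> is (\<open>line_weight_total\<close>). This is Pollak's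
  circle argument with coins: add a spot \<open>0\<close> that closes the street to a circle of \<open>n + 1\<close> spots and
  let the cars prefer any of them. On the circle every car parks, and the cars that park on the
  street without failure are exactly those that leave spot \<open>0\<close> free. The process commutes with
  rotations, so all spots are equally likely to be free in the end, and \<open>n + 1 - k\<close> of them are.

  Let \<open>k = m - 1\<close>, let \<open>T\<close> be the weight of \<open>k\<close> cars, and let \<open>h j\<close> be the probability that the last
  car fails if it prefers \<open>j\<close>, conditioned on the success of the first \<open>k\<close> cars. Then
  \<open>Q j = (1 - h j) / (n - H)\<close> with \<open>H = (\<Sum>j. h j)\<close>, hence
  \<open>Q j - 1/n = (H - n * h j) / (n * (n - H))\<close>. The weight of \<open>m\<close> cars is
  \<open>T * (n - H)\<close>, so the count for \<open>k\<close> and for \<open>m\<close> cars gives \<open>H = k / (n + 1 - k)\<close>, which stays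
  bounded by \<open>c / (1 - c)\<close>. As \<open>h \<ge> 0\<close>, the sum of the \<open>\<bar>Q j - 1/n\<bar>\<close> is at most \<open>2 * H / (n - H)\<close>, which is the upper bound.

  For the lower bound one single \<open>j\<close> with \<open>h j\<close> bounded away from \<open>0\<close> suffices, since then
  \<open>n * h j\<close> outgrows \<open>H\<close>. A car that prefers an occupied spot \<open>n\<close> fails if it goes forward, a car
  that prefers an occupied spot \<open>1\<close> fails if it goes backward; one of the two directions has
  probability at least \<open>1/2\<close>. Both ends are free with the same probability by rotation
  (\<open>line_weight_end_free_symmetric\<close>), and spot \<open>n\<close> stays free exactly if the cars park on the
  shorter street with \<open>n - 1\<close> spots (\<open>line_weight_last_free\<close>). So the count gives this probability,
  and it is at most \<open>1 / (1 + c/2)\<close> (\<open>success_count_ratio_le\<close>).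
\<close>

section \<open>Searching for a free spot on a circle\<close>

text \<open>Spots outside the circle \<open>{0..n}\<close> are fixed points. This makes the two rotations mutually
  inverse bijections of the whole type, so that they act on arbitrary sets of spots.\<close>

fun cw :: "nat \<Rightarrow> nat \<Rightarrow> nat" where
  "cw n x = (if x < n then Suc x else if x = n then 0 else x)"

fun ccw :: "nat \<Rightarrow> nat \<Rightarrow> nat" where
  "ccw n x = (if x = 0 then n else if x \<le> n then x - 1 else x)"

declare cw.simps [simp del] ccw.simps [simp del]

text \<open>Both driving directions are instances: \<open>\<sigma>\<close> is one of the two rotations. A car whose preference
  is free is covered as well, with zero moves.\<close>

definition next_free :: "(nat \<Rightarrow> nat) \<Rightarrow> nat set \<Rightarrow> nat \<Rightarrow> nat" where
  "next_free \<sigma> S a = (\<sigma> ^^ (LEAST d. (\<sigma> ^^ d) a \<notin> S)) a"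

lemma next_freeI:
  assumes "(\<sigma> ^^ d) a \<notin> S" "\<And>i. i < d \<Longrightarrow> (\<sigma> ^^ i) a \<in> S"
  shows "next_free \<sigma> S a = (\<sigma> ^^ d) a"
proof -
  have "(LEAST d. (\<sigma> ^^ d) a \<notin> S) = d"
    using assms by (intro Least_equality) (auto simp: not_less[symmetric])
  then show ?thesis by (simp add: next_free_def)
qed

lemma next_free_notin:
  assumes "(\<sigma> ^^ d) a \<notin> S"
  shows "next_free \<sigma> S a \<notin> S"
  unfolding next_free_def using assms by (rule LeastI)

lemma next_free_equivariant:
  assumes "inj \<rho>" "\<And>x. \<sigma> (\<rho> x) = \<rho> (\<sigma> x)"
  shows "next_free \<sigma> (\<rho> ` S) (\<rho> a) = \<rho> (next_free \<sigma> S a)"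
proof -
  have *: "(\<sigma> ^^ d) (\<rho> a) = \<rho> ((\<sigma> ^^ d) a)" for d
    by (induction d) (simp_all add: assms(2))
  show ?thesis
    unfolding next_free_def * by (simp add: inj_image_mem_iff[OF assms(1)])
qed

lemma cw_ccw: "cw n (ccw n x) = x" and ccw_cw: "ccw n (cw n x) = x"
  by (auto simp: cw.simps ccw.simps)

lemma inj_cw: "inj (cw n)"
  by (metis ccw_cw injI)

lemma cw_le: "x \<le> n \<Longrightarrow> cw n x \<le> n" and ccw_le: "x \<le> n \<Longrightarrow> ccw n x \<le> n"
  by (auto simp: cw.simps ccw.simps)

lemma bij_betw_cw: "bij_betw (cw n) {..n} {..n}"
  by (rule bij_betw_byWitness[where f' = "ccw n"]) (auto simp: cw_ccw ccw_cw cw_le ccw_le)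

lemma funpow_cw: "a + d \<le> n \<Longrightarrow> (cw n ^^ d) a = a + d"
  by (induction d) (auto simp: cw.simps)

lemma funpow_cw_wrap: "a \<le> n \<Longrightarrow> (cw n ^^ (Suc n - a)) a = 0"
  by (simp add: Suc_diff_le funpow_cw cw.simps)

lemma funpow_ccw: "d \<le> a \<Longrightarrow> a \<le> n \<Longrightarrow> (ccw n ^^ d) a = a - d"
  by (induction d) (auto simp: ccw.simps)

text \<open>Every spot is reached from every other one, so that no car fails on a circle with a free spot.\<close>

lemma cw_reaches:
  assumes "a \<le> n" "x \<le> n"
  shows "\<exists>d. (cw n ^^ d) a = x"
proof -
  have "(cw n ^^ (x + (Suc n - a))) a = x"
    unfolding funpow_add o_apply funpow_cw_wrap[OF assms(1)] using assms by (simp add: funpow_cw)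
  then show ?thesis by blast
qed

lemma ccw_reaches:
  assumes "a \<le> n" "x \<le> n"
  shows "\<exists>d. (ccw n ^^ d) a = x"
proof -
  have "(ccw n ^^ ((n - x) + Suc a)) a = x"
    unfolding funpow_add o_apply using assms by (simp add: funpow_ccw ccw.simps)
  then show ?thesis by blast
qed

lemma next_free_le:
  assumes "\<And>x. x \<le> n \<Longrightarrow> \<sigma> x \<le> n" "a \<le> n"
  shows "next_free \<sigma> S a \<le> n"
proof -
  have "(\<sigma> ^^ d) a \<le> n" for d by (induction d) (auto simp: assms)
  then show ?thesis by (simp add: next_free_def)
qed

lemma next_free_circle:
  assumes "S \<subset> {..n}" "a \<le> n"
  shows "next_free (cw n) S a \<notin> S" "next_free (ccw n) S a \<notin> S"
proof -
  obtain x where "x \<le> n" "x \<notin> S" using assms by auto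
  then show "next_free (cw n) S a \<notin> S" "next_free (ccw n) S a \<notin> S"
    using cw_reaches[OF assms(2), of x] ccw_reaches[OF assms(2), of x]
    by (metis next_free_notin)+
qed

section \<open>Parking on the circle\<close>

text \<open>\<open>circle_weight n p k g S\<close> is \<open>(n + 1) ^ k\<close> times the expectation of \<open>g\<close> at the final occupied set
  when \<open>k\<close> further cars with uniform preferences arrive at the occupied set \<open>S\<close>. Leaving \<open>g\<close>
  arbitrary lets one recursion describe all statistics of the final set.\<close>

fun circle_weight :: "nat \<Rightarrow> real \<Rightarrow> nat \<Rightarrow> (nat set \<Rightarrow> real) \<Rightarrow> nat set \<Rightarrow> real" where
  "circle_weight n p 0 g S = g S"
| "circle_weight n p (Suc k) g S =
     (\<Sum>a\<le>n. p * circle_weight n p k g (insert (next_free (cw n) S a) S) +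
            (1 - p) * circle_weight n p k g (insert (next_free (ccw n) S a) S))"

lemma circle_weight_rotate:
  "circle_weight n p k g (cw n ` S) = circle_weight n p k (\<lambda>S. g (cw n ` S)) S"
proof (induction k arbitrary: S)
  case (Suc k)
  have comm: "ccw n (cw n x) = cw n (ccw n x)" for x by (simp add: cw_ccw ccw_cw)
  have "circle_weight n p (Suc k) g (cw n ` S) =
     (\<Sum>a\<le>n. p * circle_weight n p k g (insert (next_free (cw n) (cw n ` S) (cw n a)) (cw n ` S)) +
            (1 - p) * circle_weight n p k g (insert (next_free (ccw n) (cw n ` S) (cw n a)) (cw n ` S)))"
    unfolding circle_weight.simps by (rule sum.reindex_bij_betw[OF bij_betw_cw, symmetric])
  also have "\<dots> = circle_weight n p (Suc k) (\<lambda>S. g (cw n ` S)) S"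
    by (simp add: next_free_equivariant inj_cw comm Suc flip: image_insert)
  finally show ?case .
qed simp

lemma circle_weight_rotate_empty:
  "circle_weight n p k (\<lambda>S. g (cw n ` S)) {} = circle_weight n p k g {}"
  using circle_weight_rotate[of n p k g "{}"] by simp

lemma circle_weight_sum:
  "circle_weight n p k (\<lambda>S. \<Sum>r\<in>R. g r S) S = (\<Sum>r\<in>R. circle_weight n p k (g r) S)"
proof (induction k arbitrary: S)
  case (Suc k)
  then show ?case
    by (simp add: sum_distrib_left sum.distrib sum.swap[of _ R])
qed simp

text \<open>Each car occupies exactly one new spot, so the number of free spots at the end is deterministic.\<close>

lemma circle_weight_free_count:
  assumes "S \<subseteq> {..n}" "card S + k \<le> Suc n"
  shows "circle_weight n p k (\<lambda>S. \<Sum>r\<le>n. of_bool (r \<notin> S)) S =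
           real (Suc n) ^ k * real (Suc n - (card S + k))"
  using assms
proof (induction k arbitrary: S)
  case 0
  have "(\<Sum>r\<le>n. of_bool (r \<notin> S)) = real (card ({..n} - S))"
    by (simp add: set_diff_eq Int_def)
  also have "\<dots> = real (Suc n - card S)"
    using 0 by (simp add: card_Diff_subset finite_subset)
  finally show ?case by simp
next
  case (Suc k)
  have fin: "finite S" using Suc.prems by (auto intro: finite_subset)
  have "S \<noteq> {..n}" using Suc.prems by auto
  then have sub: "S \<subset> {..n}" using Suc.prems by auto
  have step: "circle_weight n p k (\<lambda>S. \<Sum>r\<le>n. of_bool (r \<notin> S)) (insert x S) =
       real (Suc n) ^ k * real (Suc n - (card S + Suc k))" if "x \<notin> S" "x \<le> n" for x
    using Suc.IH[of "insert x S"] that Suc.prems fin by simp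
  have "circle_weight n p (Suc k) (\<lambda>S. \<Sum>r\<le>n. of_bool (r \<notin> S)) S =
     (\<Sum>a\<le>n. p * (real (Suc n) ^ k * real (Suc n - (card S + Suc k))) +
            (1 - p) * (real (Suc n) ^ k * real (Suc n - (card S + Suc k))))"
    unfolding circle_weight.simps
    by (intro sum.cong refl arg_cong2[where f = "(+)"] arg_cong2[where f = "(*)"] step)
       (auto simp: next_free_circle[OF sub] next_free_le cw_le ccw_le)
  also have "\<dots> = real (Suc n) ^ Suc k * real (Suc n - (card S + Suc k))"
    by (simp add: algebra_simps)
  finally show ?case .
qed

text \<open>Rotation invariance makes all spots equally likely to remain free.\<close>

lemma circle_weight_free_spot:
  "r \<le> n \<Longrightarrow> circle_weight n p k (\<lambda>S. of_bool (r \<notin> S)) {} =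
                circle_weight n p k (\<lambda>S. of_bool (0 \<notin> S)) {}"
proof (induction r)
  case (Suc r)
  have "circle_weight n p k (\<lambda>S. of_bool (Suc r \<notin> S)) {} =
        circle_weight n p k (\<lambda>S. of_bool (Suc r \<notin> cw n ` S)) {}"
    by (rule circle_weight_rotate_empty[symmetric])
  also have "(\<lambda>S. of_bool (Suc r \<notin> cw n ` S)) = (\<lambda>S. of_bool (r \<notin> S) :: real)"
    using Suc.prems inj_image_mem_iff[OF inj_cw, of n r] by (simp add: cw.simps)
  finally show ?case using Suc by simp
qed simp

text \<open>Average the previous equality over the \<open>n + 1\<close> spots and use the deterministic number of free
  spots.\<close>

lemma circle_weight_spot_0_free:
  assumes "0 < k" "k \<le> Suc n"
  shows "circle_weight n p k (\<lambda>S. of_bool (0 \<notin> S)) {} = real (Suc n - k) * real (Suc n) ^ (k - 1)"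
proof -
  have "real (Suc n) * circle_weight n p k (\<lambda>S. of_bool (0 \<notin> S)) {} =
        (\<Sum>r\<le>n. circle_weight n p k (\<lambda>S. of_bool (r \<notin> S)) {})"
    by (subst sum.cong[OF refl circle_weight_free_spot]) auto
  also have "\<dots> = real (Suc n) ^ k * real (Suc n - k)"
    using circle_weight_free_count[of "{}" n k p] assms by (simp only: circle_weight_sum) simp
  also have "\<dots> = real (Suc n) * (real (Suc n - k) * real (Suc n) ^ (k - 1))"
    using assms by (cases k) (auto simp del: of_nat_Suc)
  finally show ?thesis by (subst (asm) mult_left_cancel) auto
qed

section \<open>Parking on the line and its embedding into the circle\<close>

text \<open>A failure contributes \<open>0\<close>, so the weights below measure \<open>h\<close> or \<open>g\<close> on the event of success.\<close>

definition outcome_weight :: "(nat set \<Rightarrow> real) \<Rightarrow> nat set \<Rightarrow> nat option \<Rightarrow> real" where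
  "outcome_weight h S r = (case r of None \<Rightarrow> 0 | Some x \<Rightarrow> h (insert x S))"

definition car_weight :: "nat \<Rightarrow> real \<Rightarrow> (nat set \<Rightarrow> real) \<Rightarrow> nat set \<Rightarrow> nat \<Rightarrow> real" where
  "car_weight n p h S a =
     (if a \<notin> S then h (insert a S)
      else p * outcome_weight h S (forward_spot n S a) +
           (1 - p) * outcome_weight h S (backward_spot n S a))"

text \<open>The analogue of \<open>circle_weight\<close> for the street: \<open>n ^ k\<close> times the expectation of \<open>g\<close> at the final
  occupied set, restricted to the event that all \<open>k\<close> cars park.\<close>

fun line_weight :: "nat \<Rightarrow> real \<Rightarrow> nat \<Rightarrow> (nat set \<Rightarrow> real) \<Rightarrow> nat set \<Rightarrow> real" where
  "line_weight n p 0 g S = g S"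
| "line_weight n p (Suc k) g S = (\<Sum>a=1..n. car_weight n p (line_weight n p k g) S a)"

text \<open>A car that fails on the street runs off its end, and on the circle this means that it parks in
  the added spot \<open>0\<close>.\<close>

lemma forward_spot_circle:
  assumes "S \<subseteq> {1..n}" "a \<in> S"
  shows "next_free (cw n) S a = (case forward_spot n S a of None \<Rightarrow> 0 | Some x \<Rightarrow> x)"
proof -
  define F where "F = {k \<in> {1..n}. a < k \<and> k \<notin> S}"
  have spot: "forward_spot n S a = (if F = {} then None else Some (Min F))"
    unfolding forward_spot_def F_def Let_def ..
  have a: "1 \<le> a" "a \<le> n" using assms by auto
  show ?thesis
  proof (cases "F = {}")
    case True
    have "next_free (cw n) S a = (cw n ^^ (Suc n - a)) a"
    proof (rule next_freeI)
      show "(cw n ^^ (Suc n - a)) a \<notin> S"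
        using a assms by (auto simp: funpow_cw_wrap)
      fix i assume "i < Suc n - a"
      then show "(cw n ^^ i) a \<in> S"
        using True a assms by (cases "i = 0") (auto simp: F_def funpow_cw)
    qed
    then show ?thesis
      using True a by (simp add: spot funpow_cw_wrap)
  next
    case False
    define x where "x = Min F"
    have fin: "finite F" by (simp add: F_def)
    have "x \<in> F" unfolding x_def using False fin by simp
    then have x: "a < x" "x \<le> n" "x \<notin> S" by (auto simp: F_def)
    have mn: "y \<in> S" if "a < y" "y < x" for y
    proof (rule ccontr)
      assume "y \<notin> S"
      then have "y \<in> F" using that a x by (auto simp: F_def)
      then have "x \<le> y" unfolding x_def using fin by simp
      then show False using that by simp
    qed
    have "next_free (cw n) S a = (cw n ^^ (x - a)) a"
    proof (rule next_freeI)
      show "(cw n ^^ (x - a)) a \<notin> S" using x by (simp add: funpow_cw)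
      fix i assume i: "i < x - a"
      then show "(cw n ^^ i) a \<in> S"
        using mn[of "a + i"] x assms by (cases "i = 0") (auto simp: funpow_cw)
    qed
    then show ?thesis
      using False x by (simp add: spot funpow_cw x_def[symmetric])
  qed
qed

lemma backward_spot_circle:
  assumes "S \<subseteq> {1..n}" "a \<in> S"
  shows "next_free (ccw n) S a = (case backward_spot n S a of None \<Rightarrow> 0 | Some x \<Rightarrow> x)"
proof -
  define B where "B = {k \<in> {1..n}. k < a \<and> k \<notin> S}"
  have spot: "backward_spot n S a = (if B = {} then None else Some (Max B))"
    unfolding backward_spot_def B_def Let_def ..
  have a: "1 \<le> a" "a \<le> n" using assms by auto
  show ?thesis
  proof (cases "B = {}")
    case True
    have "next_free (ccw n) S a = (ccw n ^^ a) a"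
    proof (rule next_freeI)
      show "(ccw n ^^ a) a \<notin> S"
        using a assms by (auto simp: funpow_ccw)
      fix i assume "i < a"
      then show "(ccw n ^^ i) a \<in> S"
        using True a assms by (cases "i = 0") (auto simp: B_def funpow_ccw)
    qed
    then show ?thesis
      using True a by (simp add: spot funpow_ccw)
  next
    case False
    define x where "x = Max B"
    have fin: "finite B" by (simp add: B_def)
    have "x \<in> B" unfolding x_def using False fin by simp
    then have x: "x < a" "1 \<le> x" "x \<notin> S" by (auto simp: B_def)
    have mn: "y \<in> S" if "x < y" "y < a" for y
    proof (rule ccontr)
      assume "y \<notin> S"
      then have "y \<in> B" using that a x by (auto simp: B_def)
      then have "y \<le> x" unfolding x_def using fin by simp
      then show False using that by simp
    qed
    have "next_free (ccw n) S a = (ccw n ^^ (a - x)) a"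
    proof (rule next_freeI)
      show "(ccw n ^^ (a - x)) a \<notin> S" using x a by (simp add: funpow_ccw)
      fix i assume i: "i < a - x"
      then show "(ccw n ^^ i) a \<in> S"
        using mn[of "a - i"] x a assms by (cases "i = 0") (auto simp: funpow_ccw)
    qed
    then show ?thesis
      using False x a by (simp add: spot funpow_ccw x_def[symmetric])
  qed
qed

lemma forward_spot_SomeD: "forward_spot n S a = Some x \<Longrightarrow> x \<in> {1..n}"
proof -
  assume *: "forward_spot n S a = Some x"
  define F where "F = {k \<in> {1..n}. a < k \<and> k \<notin> S}"
  have "F \<noteq> {}" "x = Min F" using * by (auto simp: forward_spot_def F_def Let_def split: if_splits)
  moreover have "finite F" by (simp add: F_def)
  ultimately have "x \<in> F" by simp
  then show ?thesis by (simp add: F_def)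
qed

lemma backward_spot_SomeD: "backward_spot n S a = Some x \<Longrightarrow> x \<in> {1..n}"
proof -
  assume *: "backward_spot n S a = Some x"
  define F where "F = {k \<in> {1..n}. k < a \<and> k \<notin> S}"
  have "F \<noteq> {}" "x = Max F" using * by (auto simp: backward_spot_def F_def Let_def split: if_splits)
  moreover have "finite F" by (simp add: F_def)
  ultimately have "x \<in> F" by simp
  then show ?thesis by (simp add: F_def)
qed

text \<open>Occupied spots stay occupied.\<close>

lemma circle_weight_occupied:
  assumes "\<And>S. x \<in> S \<Longrightarrow> g S = 0" "x \<in> S"
  shows "circle_weight n p k g S = 0"
  using assms(2) by (induction k arbitrary: S) (auto simp: assms(1))

text \<open>While spot \<open>0\<close> is free, a car on the circle ends in \<open>0\<close> either by preferring \<open>0\<close> or by a move that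
  would fail on the street; otherwise it moves as on the street. Once \<open>0\<close> is occupied, the factor
  \<open>of_bool (0 \<notin> S)\<close> removes all contributions.\<close>

lemma line_weight_eq_circle_weight:
  assumes "S \<subseteq> {1..n}"
  shows "line_weight n p k g S = circle_weight n p k (\<lambda>S. of_bool (0 \<notin> S) * g S) S"
  using assms
proof (induction k arbitrary: S)
  case 0
  then show ?case by auto
next
  case (Suc k)
  let ?C = "circle_weight n p k (\<lambda>S. of_bool (0 \<notin> S) * g S)"
  have C0: "?C (insert 0 S) = 0" by (rule circle_weight_occupied[of 0]) auto
  have 0: "0 \<notin> S" using Suc.prems by auto
  have free: "next_free \<sigma> S a = a" if "a \<notin> S" for \<sigma> :: "nat \<Rightarrow> nat" and a
    using next_freeI[where d = 0] that by simp
  have out: "outcome_weight (line_weight n p k g) S r = ?C (insert (case r of None \<Rightarrow> 0 | Some x \<Rightarrow> x) S)"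
    if "\<And>x. r = Some x \<Longrightarrow> x \<in> {1..n}" for r
    using that Suc.prems C0 by (cases r) (auto simp: outcome_weight_def Suc.IH)
  have eq: "car_weight n p (line_weight n p k g) S a =
      p * ?C (insert (next_free (cw n) S a) S) + (1 - p) * ?C (insert (next_free (ccw n) S a) S)"
    if a: "a \<in> {1..n}" for a
  proof (cases "a \<in> S")
    case True
    have "outcome_weight (line_weight n p k g) S (forward_spot n S a) =
            ?C (insert (next_free (cw n) S a) S)"
      unfolding forward_spot_circle[OF Suc.prems True] by (rule out) (rule forward_spot_SomeD)
    moreover have "outcome_weight (line_weight n p k g) S (backward_spot n S a) =
            ?C (insert (next_free (ccw n) S a) S)"
      unfolding backward_spot_circle[OF Suc.prems True] by (rule out) (rule backward_spot_SomeD)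
    ultimately show ?thesis using True by (simp add: car_weight_def)
  next
    case False
    have "line_weight n p k g (insert a S) = ?C (insert a S)"
      using a Suc.prems by (intro Suc.IH) auto
    then show ?thesis using False by (simp add: car_weight_def free algebra_simps)
  qed
  have "circle_weight n p (Suc k) (\<lambda>S. of_bool (0 \<notin> S) * g S) S =
      (\<Sum>a\<in>insert 0 {1..n}. p * ?C (insert (next_free (cw n) S a) S) +
         (1 - p) * ?C (insert (next_free (ccw n) S a) S))"
    unfolding circle_weight.simps by (rule sum.cong) auto
  also have "\<dots> = (\<Sum>a=1..n. p * ?C (insert (next_free (cw n) S a) S) +
         (1 - p) * ?C (insert (next_free (ccw n) S a) S))"
    using C0 by (subst sum.insert) (auto simp: free[OF 0])
  also have "\<dots> = line_weight n p (Suc k) g S" using eq by simp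
  finally show ?case by (rule sym)
qed

lemma line_weight_total:
  assumes "0 < k" "k \<le> Suc n"
  shows "line_weight n p k (\<lambda>_. 1) {} = real (Suc n - k) * real (Suc n) ^ (k - 1)"
  unfolding line_weight_eq_circle_weight[OF empty_subsetI] mult_1_right
  by (rule circle_weight_spot_0_free[OF assms])

text \<open>On the circle the pairs \<open>{0, 1}\<close> and \<open>{n, 0}\<close> of neighbours differ by a rotation. This holds for
  every \<open>p\<close>, although a reflection of the street would exchange \<open>p\<close> and \<open>1 - p\<close>.\<close>

lemma line_weight_end_free_symmetric:
  assumes "1 \<le> n"
  shows "line_weight n p k (\<lambda>S. of_bool (1 \<notin> S)) {} = line_weight n p k (\<lambda>S. of_bool (n \<notin> S)) {}"
proof -
  have cw: "cw n 0 = 1" "cw n n = 0" using assms by (auto simp: cw.simps)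
  have "1 \<notin> cw n ` S \<longleftrightarrow> 0 \<notin> S" "0 \<notin> cw n ` S \<longleftrightarrow> n \<notin> S" for S
    using inj_image_mem_iff[OF inj_cw, of n 0 S] inj_image_mem_iff[OF inj_cw, of n n S] cw by auto
  then have "(\<lambda>S. of_bool (0 \<notin> cw n ` S) * of_bool (1 \<notin> cw n ` S)) =
        (\<lambda>S. of_bool (0 \<notin> S) * of_bool (n \<notin> S) :: real)"
    by (auto simp: fun_eq_iff)
  then show ?thesis
    using circle_weight_rotate_empty[of n p k "\<lambda>S. of_bool (0 \<notin> S) * of_bool (1 \<notin> S)"]
    by (simp add: line_weight_eq_circle_weight)
qed

lemma line_weight_occupied:
  assumes "\<And>S. x \<in> S \<Longrightarrow> g S = 0" "x \<in> S"
  shows "line_weight n p k g S = 0"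
  using assms(2)
  by (induction k arbitrary: S)
     (auto simp: assms(1) car_weight_def outcome_weight_def split: option.splits intro!: sum.neutral)

text \<open>If the last spot remains free, the cars cannot tell the street from the one without that spot: a
  forward move that would fail on the shorter street would have taken the last spot.\<close>

lemma line_weight_last_free:
  assumes "S \<subseteq> {1..n}"
  shows "line_weight (Suc n) p k (\<lambda>S. of_bool (Suc n \<notin> S)) S = line_weight n p k (\<lambda>_. 1) S"
  using assms
proof (induction k arbitrary: S)
  case 0
  then show ?case by auto
next
  case (Suc k)
  let ?L = "line_weight (Suc n) p k (\<lambda>S. of_bool (Suc n \<notin> S))"
  have L0: "?L (insert (Suc n) S) = 0" by (rule line_weight_occupied[of "Suc n"]) auto
  have notin: "Suc n \<notin> S" using Suc.prems by auto
  have eq: "car_weight (Suc n) p ?L S a = car_weight n p (line_weight n p k (\<lambda>_. 1)) S a"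
    if a: "a \<in> {1..n}" for a
  proof -
    define F where "F = {k \<in> {1..n}. a < k \<and> k \<notin> S}"
    have F: "{k \<in> {1..Suc n}. a < k \<and> k \<notin> S} = insert (Suc n) F"
      using a notin by (auto simp: F_def)
    have spot: "forward_spot n S a = (if F = {} then None else Some (Min F))"
      unfolding forward_spot_def F_def Let_def ..
    have spot': "forward_spot (Suc n) S a = Some (Min (insert (Suc n) F))"
      unfolding forward_spot_def F by simp
    have "outcome_weight ?L S (forward_spot (Suc n) S a) =
          outcome_weight (line_weight n p k (\<lambda>_. 1)) S (forward_spot n S a)"
    proof (cases "F = {}")
      case True
      then show ?thesis by (simp add: spot spot' outcome_weight_def L0)
    next
      case False
      have fin: "finite F" by (simp add: F_def)
      have mem: "Min F \<in> F" using False fin by simp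
      then have "Min (insert (Suc n) F) = Min F"
        using False fin by (auto simp: F_def min_def)
      moreover have "Min F \<in> {1..n}" using mem by (simp add: F_def)
      ultimately show ?thesis
        using False Suc.prems
        by (simp add: spot spot' outcome_weight_def Suc.IH)
    qed
    moreover have "backward_spot (Suc n) S a = backward_spot n S a"
    proof -
      have "{k \<in> {1..Suc n}. k < a \<and> k \<notin> S} = {k \<in> {1..n}. k < a \<and> k \<notin> S}" using a by auto
      then show ?thesis by (simp add: backward_spot_def)
    qed
    moreover have "outcome_weight ?L S (backward_spot n S a) =
          outcome_weight (line_weight n p k (\<lambda>_. 1)) S (backward_spot n S a)"
      using backward_spot_SomeD[of n S a] Suc.prems
      by (auto simp: outcome_weight_def Suc.IH split: option.splits)
    ultimately show ?thesis
      using a Suc.prems by (simp add: car_weight_def Suc.IH)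
  qed
  have "line_weight (Suc n) p (Suc k) (\<lambda>S. of_bool (Suc n \<notin> S)) S =
      (\<Sum>a=1..n. car_weight (Suc n) p ?L S a) + car_weight (Suc n) p ?L S (Suc n)"
    by simp
  also have "\<dots> = line_weight n p (Suc k) (\<lambda>_. 1) S"
    using eq notin L0 by (simp add: car_weight_def)
  finally show ?case .
qed

section \<open>From the random experiment to weights\<close>

lemma measure_bind_pmf_eq_integral:
  "measure (measure_pmf (bind_pmf M f)) X = (\<integral>x. measure (measure_pmf (f x)) X \<partial>measure_pmf M)"
proof -
  have int: "integrable (measure_pmf M) (\<lambda>x. measure (measure_pmf (f x)) X)"
    by (rule measure_pmf.integrable_const_bound[where B = 1]) auto
  have "ennreal (measure (measure_pmf (bind_pmf M f)) X) =
        (\<integral>\<^sup>+x. ennreal (measure (measure_pmf (f x)) X) \<partial>measure_pmf M)"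
    unfolding measure_pmf.emeasure_eq_measure[symmetric] by simp
  also have "\<dots> = ennreal (\<integral>x. measure (measure_pmf (f x)) X \<partial>measure_pmf M)"
    by (rule nn_integral_eq_integral[OF int]) auto
  finally show ?thesis by (simp add: integral_nonneg)
qed

definition success_prob :: "nat \<Rightarrow> real \<Rightarrow> nat set \<Rightarrow> nat list \<Rightarrow> real" where
  "success_prob n p S \<alpha> = measure (measure_pmf (park_outcomes n p S \<alpha>)) {rs. None \<notin> set rs}"

lemma success_prob_Nil: "success_prob n p S [] = 1"
  by (simp add: success_prob_def)

lemma success_prob_Cons:
  assumes "0 \<le> p" "p \<le> 1"
  shows "success_prob n p S (a # \<alpha>) = car_weight n p (\<lambda>S. success_prob n p S \<alpha>) S a"
proof -
  have *: "measure (measure_pmf (map_pmf ((#) r) (park_outcomes n p (S \<union> set_option r) \<alpha>)))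
              {rs. None \<notin> set rs} = outcome_weight (\<lambda>S. success_prob n p S \<alpha>) S r" for r
    by (cases r) (simp_all add: outcome_weight_def success_prob_def vimage_def)
  have "success_prob n p S (a # \<alpha>) =
        (\<integral>r. outcome_weight (\<lambda>S. success_prob n p S \<alpha>) S r \<partial>measure_pmf (park_spot n p S a))"
    unfolding success_prob_def park_outcomes.simps measure_bind_pmf_eq_integral
    by (simp only: * success_prob_def)
  also have "\<dots> = car_weight n p (\<lambda>S. success_prob n p S \<alpha>) S a"
    using assms by (simp add: park_spot_def car_weight_def outcome_weight_def)
  finally show ?thesis .
qed

lemma preference_lists_0: "preference_lists 0 n = {[]}"
  by (auto simp: preference_lists_def)

lemma sum_preference_lists_Suc:
  "(\<Sum>\<alpha>\<in>preference_lists (Suc k) n. f \<alpha>) =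
   (\<Sum>a=1..n. \<Sum>\<beta>\<in>preference_lists k n. f (a # \<beta>))"
proof -
  have "preference_lists (Suc k) n = (\<lambda>(a, \<beta>). a # \<beta>) ` ({1..n} \<times> preference_lists k n)"
    by (auto simp: preference_lists_def length_Suc_conv image_iff)
  moreover have "inj_on (\<lambda>(a, \<beta>). a # \<beta>) ({1..n} \<times> preference_lists k n)"
    by (auto simp: inj_on_def)
  ultimately show ?thesis
    by (simp add: sum.reindex sum.cartesian_product case_prod_unfold)
qed

lemma finite_preference_lists: "finite (preference_lists k n)"
  using finite_lists_length_eq[of "{1..n}" k] by (simp add: preference_lists_def conj_commute)

lemma preference_lists_nonempty: "1 \<le> n \<Longrightarrow> preference_lists k n \<noteq> {}"
proof -
  assume "1 \<le> n"
  then have "replicate k 1 \<in> preference_lists k n" by (auto simp: preference_lists_def)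
  then show ?thesis by blast
qed

lemma car_weight_sum:
  "car_weight n p (\<lambda>S. \<Sum>i\<in>I. c i * g i S) S a = (\<Sum>i\<in>I. c i * car_weight n p (g i) S a)"
proof -
  have "outcome_weight (\<lambda>S. \<Sum>i\<in>I. c i * g i S) S r = (\<Sum>i\<in>I. c i * outcome_weight (g i) S r)" for r
    by (cases r) (simp_all add: outcome_weight_def)
  then show ?thesis
    by (simp add: car_weight_def sum_distrib_left sum.distrib distrib_left mult.left_commute)
qed

text \<open>Fixing the preference of the last car means to run the first \<open>k\<close> cars freely and to evaluate the
  chance of the last one at the occupied set they leave.\<close>

lemma sum_success_prob_last:
  assumes "0 \<le> p" "p \<le> 1" "j \<in> {1..n}"
  shows "(\<Sum>\<alpha>\<in>preference_lists (Suc k) n. of_bool (\<alpha> ! k = j) * success_prob n p S \<alpha>) =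
         line_weight n p k (\<lambda>S. car_weight n p (\<lambda>_. 1) S j) S"
proof (induction k arbitrary: S)
  case 0
  have "(\<Sum>\<alpha>\<in>preference_lists (Suc 0) n. of_bool (\<alpha> ! 0 = j) * success_prob n p S \<alpha>) =
        (\<Sum>a=1..n. if a = j then car_weight n p (\<lambda>_. 1) S a else 0)"
    using assms unfolding sum_preference_lists_Suc
    by (intro sum.cong refl) (simp add: preference_lists_0 success_prob_Cons success_prob_Nil)
  then show ?case using assms(3) by simp
next
  case (Suc k)
  have "(\<Sum>\<alpha>\<in>preference_lists (Suc (Suc k)) n. of_bool (\<alpha> ! Suc k = j) * success_prob n p S \<alpha>) =
        (\<Sum>a=1..n. car_weight n p (\<lambda>S. \<Sum>\<beta>\<in>preference_lists (Suc k) n.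
            of_bool (\<beta> ! k = j) * success_prob n p S \<beta>) S a)"
    unfolding sum_preference_lists_Suc[of _ "Suc k"] car_weight_sum
    by (simp only: nth_Cons_Suc success_prob_Cons[OF assms(1,2)])
  then show ?case unfolding Suc.IH by simp
qed

lemma sum_success_prob:
  assumes "0 \<le> p" "p \<le> 1"
  shows "(\<Sum>\<alpha>\<in>preference_lists k n. success_prob n p S \<alpha>) = line_weight n p k (\<lambda>_. 1) S"
proof (induction k arbitrary: S)
  case 0
  then show ?case by (simp add: preference_lists_0 success_prob_Nil)
next
  case (Suc k)
  have "(\<Sum>\<alpha>\<in>preference_lists (Suc k) n. success_prob n p S \<alpha>) =
        (\<Sum>a=1..n. car_weight n p (\<lambda>S. \<Sum>\<beta>\<in>preference_lists k n. 1 * success_prob n p S \<beta>) S a)"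
    unfolding sum_preference_lists_Suc car_weight_sum
    by (simp only: success_prob_Cons[OF assms] mult_1)
  then show ?case by (simp add: Suc.IH)
qed

lemma parking_pmf_prob:
  assumes "1 \<le> n"
  shows "measure (measure_pmf (parking_pmf m n p)) {\<omega>. R (fst \<omega>) \<and> all_parked \<omega>} =
         (\<Sum>\<alpha>\<in>preference_lists m n. of_bool (R \<alpha>) * success_prob n p {} \<alpha>) /
         real (card (preference_lists m n))"
proof -
  have *: "measure (measure_pmf (map_pmf (\<lambda>rs. (\<alpha>, rs)) (park_outcomes n p {} \<alpha>)))
            {\<omega>. R (fst \<omega>) \<and> all_parked \<omega>} = of_bool (R \<alpha>) * success_prob n p {} \<alpha>" for \<alpha>
    by (simp add: vimage_def all_parked_def success_prob_def)
  show ?thesis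
    unfolding parking_pmf_def measure_bind_pmf_eq_integral *
    by (rule integral_pmf_of_set[OF preference_lists_nonempty[OF assms] finite_preference_lists])
qed

lemma Q_park_eq:
  assumes "0 \<le> p" "p \<le> 1" "j \<in> {1..n}"
  shows "Q_park (Suc k) n p j =
    line_weight n p k (\<lambda>S. car_weight n p (\<lambda>_. 1) S j) {} / line_weight n p (Suc k) (\<lambda>_. 1) {}"
proof -
  have n: "1 \<le> n" using assms by simp
  have c: "card (preference_lists (Suc k) n) \<noteq> 0"
    using preference_lists_nonempty[OF n] finite_preference_lists by simp
  have num: "measure (measure_pmf (parking_pmf (Suc k) n p)) {\<omega>. fst \<omega> ! k = j \<and> all_parked \<omega>} =
      line_weight n p k (\<lambda>S. car_weight n p (\<lambda>_. 1) S j) {} / real (card (preference_lists (Suc k) n))"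
    using parking_pmf_prob[OF n, of "Suc k" p "\<lambda>\<alpha>. \<alpha> ! k = j"]
    unfolding sum_success_prob_last[OF assms] .
  have den: "measure (measure_pmf (parking_pmf (Suc k) n p)) {\<omega>. all_parked \<omega>} =
      line_weight n p (Suc k) (\<lambda>_. 1) {} / real (card (preference_lists (Suc k) n))"
    using parking_pmf_prob[OF n, of "Suc k" p "\<lambda>_. True"]
    by (simp add: sum_success_prob[OF assms(1,2)] del: line_weight.simps)
  show ?thesis
    unfolding Q_park_def cond_prob_def using c by (simp add: num den del: line_weight.simps)
qed

lemma sum_line_weight_last:
  assumes "0 \<le> p" "p \<le> 1"
  shows "(\<Sum>j=1..n. line_weight n p k (\<lambda>S. car_weight n p (\<lambda>_. 1) S j) {}) =
         line_weight n p (Suc k) (\<lambda>_. 1) {}"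
proof -
  have one: "(\<Sum>j=1..n. of_bool (\<alpha> ! k = j) * x) = (x::real)"
    if "\<alpha> \<in> preference_lists (Suc k) n" for \<alpha> x
  proof -
    have "\<alpha> ! k \<in> set \<alpha>" using that by (simp add: preference_lists_def)
    then have "\<alpha> ! k \<in> {1..n}" using that by (auto simp only: preference_lists_def)
    then show ?thesis by (simp add: of_bool_def if_distrib[of "\<lambda>y. y * x"] cong: if_cong)
  qed
  have "(\<Sum>j=1..n. line_weight n p k (\<lambda>S. car_weight n p (\<lambda>_. 1) S j) {}) =
     (\<Sum>j=1..n. \<Sum>\<alpha>\<in>preference_lists (Suc k) n. of_bool (\<alpha> ! k = j) * success_prob n p {} \<alpha>)"
    by (intro sum.cong refl sum_success_prob_last[OF assms, symmetric])
  also have "\<dots> = (\<Sum>\<alpha>\<in>preference_lists (Suc k) n. success_prob n p {} \<alpha>)"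
    by (subst sum.swap) (intro sum.cong refl one)
  finally show ?thesis unfolding sum_success_prob[OF assms] .
qed

section \<open>The preference of the last car\<close>

lemma line_weight_mono:
  assumes "0 \<le> p" "p \<le> 1" "\<And>S. g S \<le> h S"
  shows "line_weight n p k g S \<le> line_weight n p k h S"
proof (induction k arbitrary: S)
  case (Suc k)
  have out: "outcome_weight (line_weight n p k g) S r \<le> outcome_weight (line_weight n p k h) S r" for r
    by (cases r) (simp_all add: outcome_weight_def Suc.IH)
  show ?case
    unfolding line_weight.simps car_weight_def
    using assms by (intro sum_mono) (auto intro!: add_mono mult_left_mono out Suc.IH)
qed (simp add: assms)

lemma line_weight_linear:
  "line_weight n p k (\<lambda>S. c * g S + d * h S) S = c * line_weight n p k g S + d * line_weight n p k h S"
proof (induction k arbitrary: S)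
  case (Suc k)
  have out: "outcome_weight (\<lambda>S. c * u S + d * v S) S r =
      c * outcome_weight u S r + d * outcome_weight v S r" for r u v
    by (cases r) (simp_all add: outcome_weight_def)
  have "car_weight n p (\<lambda>S. c * u S + d * v S) S a = c * car_weight n p u S a + d * car_weight n p v S a"
    for u v a
    by (simp add: car_weight_def out algebra_simps)
  moreover have "line_weight n p k (\<lambda>S. c * g S + d * h S) =
      (\<lambda>S. c * line_weight n p k g S + d * line_weight n p k h S)"
    by (rule ext) (rule Suc.IH)
  ultimately show ?case by (simp add: sum.distrib sum_distrib_left)
qed simp

lemma car_weight_le_1:
  assumes "0 \<le> p" "p \<le> 1"
  shows "car_weight n p (\<lambda>_. 1) S a \<le> 1"
proof -
  have "outcome_weight (\<lambda>_. 1) S r \<le> 1" for r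
    by (cases r) (simp_all add: outcome_weight_def)
  then have "p * outcome_weight (\<lambda>_. 1) S r + (1 - p) * outcome_weight (\<lambda>_. 1) S r' \<le> p * 1 + (1 - p) * 1"
    for r r'
    using assms by (intro add_mono mult_left_mono) auto
  then show ?thesis by (simp add: car_weight_def)
qed

text \<open>A car that prefers an occupied end of the street fails if it drives outwards.\<close>

lemma car_weight_first_le:
  assumes "0 \<le> p" "p \<le> 1"
  shows "car_weight n p (\<lambda>_. 1) S 1 \<le> p * 1 + (1 - p) * of_bool (1 \<notin> S)"
proof -
  have "outcome_weight (\<lambda>_. 1) S r \<le> 1" for r
    by (cases r) (simp_all add: outcome_weight_def)
  moreover have "backward_spot n S 1 = None" by (auto simp: backward_spot_def)
  ultimately show ?thesis
    using assms by (auto simp: car_weight_def outcome_weight_def mult_left_le)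
qed

lemma car_weight_last_le:
  assumes "0 \<le> p" "p \<le> 1"
  shows "car_weight n p (\<lambda>_. 1) S n \<le> (1 - p) * 1 + p * of_bool (n \<notin> S)"
proof -
  have "outcome_weight (\<lambda>_. 1) S r \<le> 1" for r
    by (cases r) (simp_all add: outcome_weight_def)
  moreover have "forward_spot n S n = None" by (auto simp: forward_spot_def)
  ultimately show ?thesis
    using assms by (auto simp: car_weight_def outcome_weight_def mult_left_le)
qed

section \<open>Bounds for the total variation distance\<close>

text \<open>Everything follows from \<open>Q j - 1/n = (H - n * h j) / (n * (n - H))\<close>: the terms \<open>H\<close> and
  \<open>n * h j\<close> each sum to \<open>n * H\<close>, and a single large \<open>h i\<close> already contributes order \<open>1/n\<close>.\<close>

lemma tv_dist_bounds:
  fixes h :: "nat \<Rightarrow> real"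
  assumes n: "1 \<le> n" and Q: "\<And>j. j \<in> {1..n} \<Longrightarrow> Q j = (1 - h j) / (real n - H)"
    and h: "\<And>j. j \<in> {1..n} \<Longrightarrow> 0 \<le> h j" and H: "(\<Sum>j=1..n. h j) = H" and small: "2 * H \<le> real n"
  shows "tv_dist n Q (Uni n) \<le> 2 * H / real n"
    and "i \<in> {1..n} \<Longrightarrow> \<delta> \<le> h i \<Longrightarrow> 2 * H \<le> \<delta> * real n \<Longrightarrow> \<delta> / 4 / real n \<le> tv_dist n Q (Uni n)"
proof -
  have H0: "0 \<le> H" unfolding H[symmetric] by (intro sum_nonneg h) auto
  have pos: "0 < real n - H" using small H0 n by linarith
  have Uni: "Uni n j = 1 / real n" if "j \<in> {1..n}" for j
    using that unfolding Uni_def by (subst pmf_of_set) auto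
  have diff: "Q j - Uni n j = (H - real n * h j) / (real n * (real n - H))" if "j \<in> {1..n}" for j
    using pos n by (simp add: Q[OF that] Uni[OF that] divide_simps) (simp add: algebra_simps)
  have adiff: "\<bar>Q j - Uni n j\<bar> = \<bar>H - real n * h j\<bar> / (real n * (real n - H))" if "j \<in> {1..n}" for j
    unfolding diff[OF that] using pos n by (simp add: abs_divide abs_mult)
  have "(\<Sum>j=1..n. \<bar>Q j - Uni n j\<bar>) \<le> (\<Sum>j=1..n. (H + real n * h j) / (real n * (real n - H)))"
  proof (rule sum_mono)
    fix j assume j: "j \<in> {1..n}"
    have "0 \<le> real n * h j" using h[OF j] by simp
    then show "\<bar>Q j - Uni n j\<bar> \<le> (H + real n * h j) / (real n * (real n - H))"
      unfolding adiff[OF j] using H0 pos by (intro divide_right_mono) auto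
  qed
  also have "\<dots> = 2 * H / (real n - H)"
    unfolding sum_divide_distrib[symmetric] sum.distrib sum_distrib_left[symmetric] H
    using n pos by (simp add: divide_simps)
  finally have "tv_dist n Q (Uni n) \<le> H / (real n - H)"
    by (simp add: tv_dist_def mult.commute)
  also have "\<dots> \<le> H / (real n / 2)"
    using small H0 n pos by (intro divide_left_mono) auto
  finally show "tv_dist n Q (Uni n) \<le> 2 * H / real n" by (simp add: mult.commute)
  assume i: "i \<in> {1..n}" and \<delta>: "\<delta> \<le> h i" "2 * H \<le> \<delta> * real n"
  have "\<delta> * real n \<le> real n * h i"
    using \<delta>(1) by (subst mult.commute, intro mult_left_mono) auto
  then have "\<delta> * real n / 2 \<le> \<bar>H - real n * h i\<bar>" using \<delta>(2) by linarith
  then have "(\<delta> * real n / 2) / (real n * (real n - H)) \<le> \<bar>Q i - Uni n i\<bar>"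
    unfolding adiff[OF i] using pos by (intro divide_right_mono) auto
  moreover have "\<delta> / 2 / real n \<le> \<delta> / 2 / (real n - H)"
  proof -
    have "0 \<le> \<delta> * real n" using \<delta>(2) H0 by linarith
    then have "0 \<le> \<delta>" using n by (simp add: zero_le_mult_iff)
    then show ?thesis using H0 pos n by (intro divide_left_mono) auto
  qed
  ultimately have "\<delta> / 2 / real n \<le> \<bar>Q i - Uni n i\<bar>"
    using n by simp
  also have "\<dots> \<le> (\<Sum>j=1..n. \<bar>Q j - Uni n j\<bar>)"
    using i by (intro member_le_sum) auto
  finally show "\<delta> / 4 / real n \<le> tv_dist n Q (Uni n)" by (simp add: tv_dist_def)
qed

text \<open>The two sides compare the counts for streets with \<open>n - 1\<close> and \<open>n\<close> spots; Bernoulli's inequality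
  for \<open>((n + 1) / n) ^ (k - 1)\<close> gives the gain.\<close>

lemma success_count_ratio_le:
  assumes "0 < k" "k \<le> n" "1 \<le> n"
  shows "real (n - k) * real n ^ (k - 1) * (1 + real (k - 1) / real n) \<le>
         real (Suc n - k) * real (Suc n) ^ (k - 1)"
proof -
  have "1 + real (k - 1) * (1 / real n) \<le> (1 + 1 / real n) ^ (k - 1)"
    by (rule Bernoulli_inequality, rule order_trans[of _ 0]) auto
  then have "real n ^ (k - 1) * (1 + real (k - 1) / real n) \<le> real n ^ (k - 1) * (1 + 1 / real n) ^ (k - 1)"
    by (intro mult_left_mono) auto
  also have "\<dots> = (real n * (1 + 1 / real n)) ^ (k - 1)"
    by (rule power_mult_distrib[symmetric])
  also have "real n * (1 + 1 / real n) = real (Suc n)"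
    using assms by (simp add: distrib_left)
  finally have "real (n - k) * (real n ^ (k - 1) * (1 + real (k - 1) / real n)) \<le>
      real (Suc n - k) * real (Suc n) ^ (k - 1)"
    by (intro mult_mono) auto
  then show ?thesis by (simp only: mult.assoc)
qed

text \<open>The constant \<open>\<delta> = c / (4 + 2 * c)\<close> is half of \<open>1 - 1 / (1 + c/2)\<close>: a lower bound for the
  probability that an end of the street is occupied, times the probability of at least \<open>1/2\<close> to drive outwards at the better end.
  The bound \<open>4 / c \<le> n\<close> gives \<open>(m - 2) / n \<ge> c / 2\<close>, the other one \<open>2 * H \<le> \<delta> * n\<close>.\<close>

lemma tv_dist_Q_park:
  fixes c p :: real and n m :: nat
  assumes c: "0 < c" "c < 1" and p: "0 \<le> p" "p \<le> 1" and m: "real m = c * real n"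
    and n1: "4 / c \<le> real n" and n2: "2 * (c / (1 - c)) / (c / (4 + 2 * c)) \<le> real n"
  shows "c / (4 + 2 * c) / 4 / real n \<le> tv_dist n (Q_park m n p) (Uni n)"
    and "tv_dist n (Q_park m n p) (Uni n) \<le> 2 * (c / (1 - c)) / real n"
proof -
  define \<delta> where "\<delta> = c / (4 + 2 * c)"
  have \<delta>: "0 < \<delta>" "\<delta> \<le> 1" using c by (auto simp: \<delta>_def field_simps)
  have m4: "4 \<le> m" using n1 m c by (simp add: field_simps)
  have mn: "real m < real n" using m c m4 by (cases "n = 0") auto
  define k where "k = m - 1"
  have m_eq: "m = Suc k" and k: "0 < k" "k < n" "1 \<le> n" using m4 mn by (auto simp: k_def)
  define G where "G j = line_weight n p k (\<lambda>S. car_weight n p (\<lambda>_. 1) S j) {}" for j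
  define T where "T = line_weight n p k (\<lambda>_. 1) {}"
  have T_eq: "T = real (Suc n - k) * real (Suc n) ^ (k - 1)"
    unfolding T_def using k by (intro line_weight_total) auto
  have T: "0 < T" unfolding T_eq using k by simp
  define h where "h j = 1 - G j / T" for j
  define H where "H = real k / (real n + 1 - real k)"
  have A: "line_weight n p (Suc k) (\<lambda>_. 1) {} = T * (real n - H)"
  proof -
    have "line_weight n p (Suc k) (\<lambda>_. 1) {} = real (n - k) * real (Suc n) ^ k"
      using k line_weight_total[of "Suc k" n p] by simp
    also have "\<dots> = real (n - k) * real (Suc n) * real (Suc n) ^ (k - 1)"
      using k by (cases k) auto
    also have "real (n - k) * real (Suc n) = real (Suc n - k) * (real n - H)"
      using k by (simp add: H_def field_simps of_nat_diff)
    finally show ?thesis by (simp add: T_eq)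
  qed
  have Q: "Q_park m n p j = (1 - h j) / (real n - H)" if "j \<in> {1..n}" for j
    unfolding m_eq Q_park_eq[OF p that] A by (simp add: h_def G_def)
  have G_le: "G j \<le> T" for j
    unfolding G_def T_def by (intro line_weight_mono p car_weight_le_1)
  have h0: "0 \<le> h j" if "j \<in> {1..n}" for j using G_le[of j] T by (simp add: h_def)
  \<comment> \<open>Summing over the preference of the last car must give the weight of \<open>m\<close> cars; this forces
    the sum of \<open>h\<close> to be the explicit number \<open>H\<close>.\<close>
  have "(\<Sum>j=1..n. G j) = T * (real n - H)"
    unfolding G_def sum_line_weight_last[OF p] A ..
  then have sum_h: "(\<Sum>j=1..n. h j) = H"
    using T unfolding h_def sum_subtractf sum_divide_distrib[symmetric] by simp
  have H_le: "H \<le> c / (1 - c)"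
  proof -
    have "H \<le> real m / (real n - real m)"
      unfolding H_def using k mn by (intro frac_le) (auto simp: m_eq)
    also have "\<dots> = c * real n / ((1 - c) * real n)" by (simp add: m algebra_simps)
    also have "\<dots> = c / (1 - c)" using k by simp
    finally show ?thesis .
  qed
  have big: "2 * (c / (1 - c)) \<le> \<delta> * real n"
    using n2 unfolding \<delta>_def[symmetric] pos_divide_le_eq[OF \<delta>(1)] by (simp only: mult.commute)
  have big': "2 * H \<le> \<delta> * real n" using H_le big by linarith
  have "\<delta> * real n \<le> 1 * real n" using \<delta> by (intro mult_right_mono) auto
  then have small: "2 * H \<le> real n" using big' by linarith
  \<comment> \<open>\<open>q\<close> is the probability that spot \<open>n\<close> is free, given that the first \<open>k\<close> cars park.\<close>
  define q where "q = real (n - k) * real n ^ (k - 1) / T"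
  have last_free: "line_weight n p k (\<lambda>S. of_bool (n \<notin> S)) {} = q * T"
  proof -
    obtain n' where n': "n = Suc n'" using k by (cases n) auto
    have "line_weight n p k (\<lambda>S. of_bool (n \<notin> S)) {} = line_weight n' p k (\<lambda>_. 1) {}"
      unfolding n' by (rule line_weight_last_free) simp
    also have "\<dots> = real (Suc n' - k) * real (Suc n') ^ (k - 1)"
      using k n' by (intro line_weight_total) auto
    finally show ?thesis using T by (simp add: q_def n')
  qed
  have q: "2 * \<delta> \<le> 1 - q"
  proof -
    have "real (k - 1) / real n \<ge> c / 2"
    proof -
      have "real (k - 1) = c * real n - 2" using m m4 by (simp add: k_def of_nat_diff)
      moreover have "4 \<le> c * real n" using m m4 by linarith
      ultimately show ?thesis using k by (simp add: field_simps)
    qed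
    have "q * (1 + c / 2) \<le> q * (1 + real (k - 1) / real n)"
      using \<open>real (k - 1) / real n \<ge> c / 2\<close> T by (intro mult_left_mono) (auto simp: q_def)
    also have "\<dots> = real (n - k) * real n ^ (k - 1) * (1 + real (k - 1) / real n) / T"
      by (simp add: q_def)
    also have "\<dots> \<le> T / T"
      unfolding T_eq[symmetric] using T success_count_ratio_le[of k n] k
      by (intro divide_right_mono) (auto simp: T_eq)
    finally have "q * (1 + c / 2) \<le> 1" using T by simp
    then have "q \<le> 1 / (1 + c / 2)" using c by (simp add: le_divide_eq)
    moreover have "1 - 1 / (1 + c / 2) = 2 * \<delta>" using c by (simp add: \<delta>_def field_simps)
    ultimately show ?thesis by linarith
  qed
  have h_n: "p * (1 - q) \<le> h n"
  proof -
    have "G n \<le> line_weight n p k (\<lambda>S. (1 - p) * 1 + p * of_bool (n \<notin> S)) {}"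
      unfolding G_def by (intro line_weight_mono p car_weight_last_le)
    also have "\<dots> = (1 - p) * T + p * (q * T)"
      unfolding line_weight_linear last_free T_def ..
    finally show ?thesis using T by (simp add: h_def field_simps)
  qed
  have h_1: "(1 - p) * (1 - q) \<le> h 1"
  proof -
    have "G 1 \<le> line_weight n p k (\<lambda>S. p * 1 + (1 - p) * of_bool (1 \<notin> S)) {}"
      unfolding G_def by (intro line_weight_mono p car_weight_first_le)
    also have "\<dots> = p * T + (1 - p) * (q * T)"
      unfolding line_weight_linear line_weight_end_free_symmetric[OF k(3)] last_free T_def ..
    finally show ?thesis using T by (simp add: h_def field_simps)
  qed
  obtain i where i: "i \<in> {1..n}" "\<delta> \<le> h i"
  proof (cases "p \<ge> 1 / 2")
    case True
    have "(1 / 2) * (2 * \<delta>) \<le> p * (1 - q)" using True q \<delta> by (intro mult_mono) auto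
    then show ?thesis using h_n k by (intro that[of n]) auto
  next
    case False
    have "(1 / 2) * (2 * \<delta>) \<le> (1 - p) * (1 - q)" using False q \<delta> by (intro mult_mono) auto
    then show ?thesis using h_1 k by (intro that[of 1]) auto
  qed
  show "c / (4 + 2 * c) / 4 / real n \<le> tv_dist n (Q_park m n p) (Uni n)"
    unfolding \<delta>_def[symmetric]
    by (rule tv_dist_bounds(2)[OF k(3) _ _ sum_h small i big']) (rule Q h0; assumption)+
  have "tv_dist n (Q_park m n p) (Uni n) \<le> 2 * H / real n" 
    by (rule tv_dist_bounds(1)[OF k(3) _ _ sum_h small]) (rule Q h0; assumption)+
  also have "\<dots> \<le> 2 * (c / (1 - c)) / real n"
    using H_le by (intro divide_right_mono mult_left_mono) auto
  finally show "tv_dist n (Q_park m n p) (Uni n) \<le> 2 * (c / (1 - c)) / real n" .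
qed

theorem proposition3p4:
  fixes c p :: real
  assumes "0 < c" and "c < 1" and "0 \<le> p" and "p \<le> 1"
  shows "\<exists>C1 > 0. \<exists>C2 > 0. \<forall>\<^sub>F n in sequentially. \<forall>m :: nat. real m = c * real n \<longrightarrow>
           C1 / real n \<le> tv_dist n (Q_park m n p) (Uni n) \<and>
           tv_dist n (Q_park m n p) (Uni n) \<le> C2 / real n"
proof -
  have large: "\<forall>\<^sub>F n in sequentially. x \<le> real n" for x
    by (rule eventually_sequentiallyI[of "nat \<lceil>x\<rceil>"]) linarith
  have "\<forall>\<^sub>F n in sequentially. 4 / c \<le> real n \<and> 2 * (c / (1 - c)) / (c / (4 + 2 * c)) \<le> real n"
    by (intro eventually_conj large)
  then have "\<forall>\<^sub>F n in sequentially. \<forall>m :: nat. real m = c * real n \<longrightarrow>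
           c / (4 + 2 * c) / 4 / real n \<le> tv_dist n (Q_park m n p) (Uni n) \<and>
           tv_dist n (Q_park m n p) (Uni n) \<le> 2 * (c / (1 - c)) / real n"
    by eventually_elim (use tv_dist_Q_park[OF assms] in blast)
  moreover have "0 < c / (4 + 2 * c) / 4" "0 < 2 * (c / (1 - c))" using assms by simp_all
  ultimately show ?thesis by blast
qed

end
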